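(* For integers $r$ and $d$ with $2\le d\le r/2$, let $\rho$ denote the remainder of the division of $r$ by $2d$. Then $$ \beta_r(d) \ge \sum_{\substack{0\le i\le 2d-\rho,\ 0\le j\le\rho \\ i+j=d}} \binom{2d-\rho}{i} \binom{\rho}{j} \left\lfloor\frac{r}{2d}\right\rfloor^i \left(\left\lfloor\frac{r}{2d}\right\rfloor+1\right)^j, $$ where the sum is over integers $i,j$. Consequently, $$ \beta_r(d) \ge \binom{2d}{d}\left\lfloor\frac{r}{2d}\right\rfloor^d. $$
   Context: Let $\mathbb{F}_2^r$ be the $r$-dimensional vector space over the two-element field, and let $0\le d\le r$ be an integer. A subset $B\subseteq\mathbb{F}_2^r$ is called $d$-non-blocking if for every $v\in\mathbb{F}_2^r$ there exists a linear subspace $L_v\le\mathbb{F}_2^r$ of codimension $d$ (that is, of dimension $r-d$) such that $(v+(L_v\setminus\{0\}))\cap B=\varnothing$. By $\beta_r(d)$ we denote the largest possible size of a $d$-non-blocking subset of $\mathbb{F}_2^r$. *)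

theory Defs
  imports "HOL-Analysis.Analysis" "HOL-Library.Z2"
begin

(* The space F_2^r is "bit ^ 'n" with CARD('n) = r; subspaces and their dimensions are taken
   over the field bit.  Codimension d is written additively to avoid truncated subtraction. *)
definition non_blocking :: "nat \<Rightarrow> (bit ^ 'n::finite) set \<Rightarrow> bool" where
  "non_blocking d B \<longleftrightarrow>
     (\<forall>v. \<exists>L. vec.subspace L \<and> vec.dim L + d = CARD('n) \<and> (\<lambda>x. v + x) ` (L - {0}) \<inter> B = {})"

definition beta :: "'n::finite itself \<Rightarrow> nat \<Rightarrow> nat" where
  "beta (_ :: 'n itself) d = Max (card ` {B :: (bit ^ 'n) set. non_blocking d B})"

(* The two facts below show that, for d at most the dimension, the Max in beta ranges over a
   finite nonempty set and so is the largest size. *)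
instance bit :: finite
  by standard (rule finite_subset[of _ "{0, 1}"], auto intro: bit_not_zero_iff[THEN iffD1])

lemma non_blocking_empty:
  assumes "d \<le> CARD('n::finite)"
  shows "non_blocking d ({} :: (bit ^ 'n) set)"
proof -
  obtain D :: "'n set" where D: "card D = CARD('n) - d"
    using obtain_subset_with_card_n[of "CARD('n) - d" "UNIV :: 'n set"] by auto
  let ?L = "{x :: bit ^ 'n. \<forall>i. i \<notin> D \<longrightarrow> x $ i = 0}"
  have "vec.subspace ?L"
    by (auto simp: vec.subspace_def)
  moreover have "vec.dim ?L + d = CARD('n)"
    using dim_substandard_cart[of D, where 'a = bit] D assms by simp
  ultimately show ?thesis
    unfolding non_blocking_def by blast
qed

end

theory Submission
  imports Defs
begin

text \<open>
  Partition the coordinates into \<open>2d\<close> blocks of nearly equal size, and let \<open>B\<close> consist of the vectors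
  of weight \<open>d\<close> with at most one \<open>1\<close> in each block.  For every \<open>v\<close> one needs at most \<open>d\<close>
  functionals that jointly distinguish \<open>v\<close> from all other elements of \<open>B\<close>; their common kernel then
  contains a suitable \<open>L\<^sub>v\<close>.  An element of \<open>B\<close> has odd parity on exactly \<open>d\<close> of the blocks.  If \<open>v\<close>
  does not, then some \<open>d + 1\<close> blocks have equal parities in \<open>v\<close>, which is impossible in \<open>B\<close>, and \<open>d\<close>
  differences of block parities detect this.  If it does, either two coordinates of the support of
  \<open>v\<close> lie in one block, and reading off these two suffices, or \<open>v\<close> itself is in \<open>B\<close> and reading off
  the \<open>d\<close> coordinates of its support suffices.
\<close>

section \<open>Common kernels of additive functionals over \<open>bit\<close>\<close>

lemma bit_add_eq_0_iff: "x + y = 0 \<longleftrightarrow> x = y" for x y :: bit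
  by (cases x; cases y) auto

text \<open>The only scalars are 0 and 1, so an additive map into \<open>bit\<close> is
  automatically linear.\<close>

lemma subspace_Int_kernels:
  fixes F :: "(bit ^ 'n::finite \<Rightarrow> bit) set"
  assumes "\<And>f. f \<in> F \<Longrightarrow> Modules.additive f"
  shows "vec.subspace {x. \<forall>f\<in>F. f x = 0}"
proof -
  have "f (c *s x) = 0" if "f \<in> F" "f x = 0" for f c x
    using that Modules.additive.zero[OF assms] by (cases c) auto
  moreover have "f (x + y) = 0" if "f \<in> F" "f x = 0" "f y = 0" for f x y
    using that by (simp add: Modules.additive.add[OF assms])
  ultimately show ?thesis
    using Modules.additive.zero[OF assms] by (auto simp: vec.subspace_def)
qed

text \<open>Each further functional \<open>g\<close> costs at most one dimension. If
  \<open>g z = 1\<close> for some \<open>z\<close> in the old kernel, then for any \<open>x\<close>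
  there, \<open>x\<close> or \<open>x - z\<close> is killed by \<open>g\<close>, because
  \<open>g\<close> has only two values.\<close>

lemma dim_Int_kernels:
  fixes F :: "(bit ^ 'n::finite \<Rightarrow> bit) set"
  assumes "finite F" "\<And>f. f \<in> F \<Longrightarrow> Modules.additive f"
  shows "CARD('n) \<le> vec.dim {x. \<forall>f\<in>F. f x = 0} + card F"
  using assms
proof (induction F rule: finite_induct)
  case empty
  then show ?case by (simp add: card_cart_basis)
next
  case (insert g F)
  let ?L = "{x. \<forall>f\<in>F. f x = 0}" and ?L' = "{x. \<forall>f\<in>insert g F. f x = 0}"
  have "vec.dim ?L \<le> vec.dim ?L' + 1"
  proof (cases "?L \<subseteq> ?L'")
    case True
    then show ?thesis using vec.dim_subset[OF True] by linarith
  next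
    case False
    then obtain z where z: "z \<in> ?L" "z \<notin> ?L'" by blast
    then have "g z = 1" by auto
    have "?L \<subseteq> vec.span (insert z ?L')"
    proof
      fix x assume x: "x \<in> ?L"
      have diff: "f (x - z) = f x - f z" if "f \<in> insert g F" for f
        using that insert.prems Modules.additive.diff by blast
      show "x \<in> vec.span (insert z ?L')"
      proof (cases "g x = 0")
        case True
        then show ?thesis using x by (auto intro: vec.span_base)
      next
        case False
        then have eq: "f x = f z" if "f \<in> insert g F" for f
          using that x z(1) \<open>g z = 1\<close> by auto
        have "f (x - z) = 0" if "f \<in> insert g F" for f
          using diff[OF that] eq[OF that] by simp
        then have "x - z \<in> ?L'" by blast
        then have "(x - z) + z \<in> vec.span (insert z ?L')"
          by (intro vec.span_add vec.span_base) auto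
        then show ?thesis by simp
      qed
    qed
    then have "vec.dim ?L \<le> vec.dim (insert z ?L')" by (rule vec.dim_mono)
    then show ?thesis by (simp add: vec.dim_insert split: if_splits)
  qed
  then show ?case using insert by simp
qed

text \<open>Translating \<open>v\<close> by the common kernel of \<open>F\<close> preserves the
  values of all functionals in \<open>F\<close>. If these values single out \<open>v\<close> within
  \<open>B\<close>, the translate meets \<open>B\<close> at most in \<open>v\<close> itself.\<close>

lemma non_blockingI:
  fixes B :: "(bit ^ 'n::finite) set"
  assumes "d \<le> CARD('n)"
    and ex: "\<And>v. \<exists>F :: (bit ^ 'n \<Rightarrow> bit) set. finite F \<and> card F \<le> d \<and> (\<forall>f\<in>F. Modules.additive f) \<and>
               (\<forall>b\<in>B. (\<forall>f\<in>F. f b = f v) \<longrightarrow> b = v)"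
  shows "non_blocking d B"
  unfolding non_blocking_def
proof
  fix v
  obtain F :: "(bit ^ 'n \<Rightarrow> bit) set" where F: "finite F" "card F \<le> d" "\<And>f. f \<in> F \<Longrightarrow> Modules.additive f"
    and sep: "\<And>b. b \<in> B \<Longrightarrow> \<forall>f\<in>F. f b = f v \<Longrightarrow> b = v"
    using ex[of v] by metis
  let ?K = "{x. \<forall>f\<in>F. f x = 0}"
  have "CARD('n) - d \<le> vec.dim ?K"
    using dim_Int_kernels[OF F(1,3)] F(2) by linarith
  \<comment> \<open>The kernel may be too large, while the codimension must be exactly
    \<open>d\<close>; avoiding \<open>B\<close> passes to smaller subspaces.\<close>
  then obtain L where L: "vec.subspace L" "L \<subseteq> vec.span ?K" "vec.dim L = CARD('n) - d"
    by (rule vec.choose_subspace_of_subspace)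
  have "vec.span ?K = ?K"
    using subspace_Int_kernels F(3) by (intro vec.span_eq_iff[THEN iffD2]) blast
  then have "f x = 0" if "x \<in> L" "f \<in> F" for x f
    using that L(2) by blast
  then have "f (v + x) = f v" if "x \<in> L" "f \<in> F" for x f
    using that Modules.additive.add[OF F(3)] by (metis add.right_neutral)
  then have "v + x \<notin> B" if "x \<in> L - {0}" for x
    using sep[of "v + x"] that by auto
  then have "(\<lambda>x. v + x) ` (L - {0}) \<inter> B = {}" by auto
  then show "\<exists>L. vec.subspace L \<and> vec.dim L + d = CARD('n) \<and> (\<lambda>x. v + x) ` (L - {0}) \<inter> B = {}"
    using L assms(1) by auto
qed

section \<open>Block parities and the family of transversals\<close>

definition supp :: "bit ^ 'n \<Rightarrow> 'n set" where
  "supp x = {i. x $ i = 1}"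

definition block_parity :: "('n::finite \<Rightarrow> nat) \<Rightarrow> nat \<Rightarrow> bit ^ 'n \<Rightarrow> bit" where
  "block_parity c k x = (\<Sum>i | c i = k. x $ i)"

definition transversals :: "('n::finite \<Rightarrow> nat) \<Rightarrow> nat \<Rightarrow> (bit ^ 'n) set" where
  "transversals c d = {b. card (supp b) = d \<and> inj_on c (supp b)}"

lemma supp_eq_iff: "supp x = supp y \<longleftrightarrow> x = y"
proof
  assume eq: "supp x = supp y"
  have "x $ i = y $ i" for i
  proof -
    have "x $ i = 1 \<longleftrightarrow> y $ i = 1" using eq by (auto simp: supp_def)
    then show ?thesis by (cases "x $ i"; cases "y $ i") simp_all
  qed
  then show "x = y" by (simp add: vec_eq_iff)
qed simp

lemma additive_nth: "Modules.additive (\<lambda>x :: bit ^ 'n. x $ i)"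
  by (simp add: Modules.additive_def)

lemma additive_plus:
  assumes "Modules.additive f" "Modules.additive g"
  shows "Modules.additive (\<lambda>x. f x + g x)"
  using assms unfolding Modules.additive_def by (metis add.assoc add.left_commute)

lemma additive_block_parity: "Modules.additive (block_parity c k)"
proof
  fix x y :: "bit ^ 'a"
  have "block_parity c k (x + y) = (\<Sum>i | c i = k. x $ i + y $ i)"
    unfolding block_parity_def by (intro sum.cong refl vector_add_component)
  then show "block_parity c k (x + y) = block_parity c k x + block_parity c k y"
    unfolding block_parity_def sum.distrib .
qed

text \<open>By injectivity each block contributes at most one nonzero summand, so nothing
  cancels.\<close>

lemma block_parity_eq_1_iff:
  assumes "inj_on c (supp x)"
  shows "block_parity c k x = 1 \<longleftrightarrow> k \<in> c ` supp x"
proof (cases "k \<in> c ` supp x")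
  case True
  then obtain i where i: "k = c i" "i \<in> supp x" by blast
  have "x $ j = 0" if "c j = k" "j \<noteq> i" for j
  proof -
    have "j \<notin> supp x" using inj_onD[OF assms, of i j] that i by auto
    then show ?thesis by (simp add: supp_def)
  qed
  then have "(\<Sum>j | c j = k. x $ j) = (\<Sum>j | c j = k. if j = i then 1 else 0)"
    using i by (intro sum.cong) (auto simp: supp_def)
  then show ?thesis using True i by (simp add: block_parity_def)
next
  case False
  then have "x $ i = 0" if "c i = k" for i
    using that by (auto simp: supp_def)
  then show ?thesis using False by (simp add: block_parity_def)
qed

lemma non_blocking_transversals:
  fixes c :: "'n::finite \<Rightarrow> nat"
  assumes c: "\<And>i. c i < 2 * d" and d: "2 \<le> d" "d \<le> CARD('n)"
  shows "non_blocking d (transversals c d)"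
proof (rule non_blockingI[OF d(2)])
  fix v :: "bit ^ 'n"
  define odds where "odds x = {k \<in> {..<2 * d}. block_parity c k x = 1}" for x
  have odds_inj: "odds x = c ` supp x" if "inj_on c (supp x)" for x
    using block_parity_eq_1_iff[OF that] c by (auto simp: odds_def)
  show "\<exists>F :: (bit ^ 'n \<Rightarrow> bit) set. finite F \<and> card F \<le> d \<and> (\<forall>f\<in>F. Modules.additive f) \<and>
          (\<forall>b\<in>transversals c d. (\<forall>f\<in>F. f b = f v) \<longrightarrow> b = v)"
  proof (cases "card (odds v) = d")
    case True
    \<comment> \<open>Agreement with \<open>v\<close> on \<open>S\<close> forces ones on all of
      \<open>S\<close>, so it is enough that no transversal other than \<open>v\<close> has a
      support containing \<open>S\<close>.\<close>
    obtain S where S: "S \<subseteq> supp v" "card S \<le> d"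
      and sep: "\<And>b. b \<in> transversals c d \<Longrightarrow> S \<subseteq> supp b \<Longrightarrow> b = v"
    proof (cases "inj_on c (supp v)")
      case inj: True
      then have "card (supp v) = d"
        using True odds_inj[OF inj] card_image[OF inj] by simp
      moreover have "b = v" if "b \<in> transversals c d" "supp v \<subseteq> supp b" for b
      proof -
        have "card (supp v) = card (supp b)"
          using that(1) \<open>card (supp v) = d\<close> by (simp add: transversals_def)
        then have "supp v = supp b" using that(2) by (intro card_subset_eq) auto
        then show "b = v" by (simp add: supp_eq_iff)
      qed
      ultimately show ?thesis by (intro that[of "supp v"]) auto
    next
      case False
      then obtain i j where ij: "i \<in> supp v" "j \<in> supp v" "c i = c j" "i \<noteq> j"
        by (auto simp: inj_on_def)
      moreover have "\<not> {i, j} \<subseteq> supp b" if "b \<in> transversals c d" for b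
        using that ij by (auto simp: transversals_def inj_on_def)
      \<comment> \<open>\<open>sep\<close> holds vacuously here; the pair fits the budget of
        \<open>d\<close> functionals since \<open>2 \<le> d\<close>.\<close>
      ultimately show ?thesis using d(1) by (intro that[of "{i, j}"]) auto
    qed
    let ?F = "(\<lambda>i (x :: bit ^ 'n). x $ i) ` S"
    have "card ?F \<le> d" using S(2) by (meson card_image_le finite le_trans)
    moreover have "\<forall>b\<in>transversals c d. (\<forall>f\<in>?F. f b = f v) \<longrightarrow> b = v"
      using S(1) by (intro ballI impI sep) (auto simp: supp_def)
    moreover have "finite ?F" "\<forall>f\<in>?F. Modules.additive f" by (auto intro: additive_nth)
    ultimately show ?thesis
      by (intro exI[of _ ?F] conjI)
  next
    case False
    \<comment> \<open>The odd and even blocks together number \<open>2 * d\<close>. As there are not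
      exactly \<open>d\<close> odd ones, one of the two classes has at least \<open>d + 1\<close>
      blocks.\<close>
    obtain K s where K: "K \<subseteq> {..<2 * d}" "card K = d + 1" "\<And>k. k \<in> K \<Longrightarrow> block_parity c k v = s"
    proof (cases "card (odds v) > d")
      case True
      then obtain K where "K \<subseteq> odds v" "card K = d + 1"
        using obtain_subset_with_card_n[of "d + 1" "odds v"] by auto
      then show ?thesis using that[of K 1] by (auto simp: odds_def)
    next
      case le: False
      have "card ({..<2 * d} - odds v) = 2 * d - card (odds v)"
        by (subst card_Diff_subset) (auto simp: odds_def)
      then have "d + 1 \<le> card ({..<2 * d} - odds v)"
        using le False by linarith
      then obtain K where K: "K \<subseteq> {..<2 * d} - odds v" "card K = d + 1"
        by (rule obtain_subset_with_card_n)
      have "block_parity c k v = 0" if "k \<in> K" for k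
      proof -
        have "k \<in> {..<2 * d} - odds v" using that K(1) by blast
        then show ?thesis by (simp add: odds_def)
      qed
      then show ?thesis using that[of K 0] K by blast
    qed
    then obtain k0 where k0: "k0 \<in> K" by fastforce
    have finK: "finite K" using K(1) finite_subset by blast
    \<comment> \<open>Comparing with a reference block \<open>k0\<close> turns \<open>d + 1\<close>
      parities into \<open>d\<close> functionals; in characteristic 2 the sum is the
      difference.\<close>
    let ?F = "(\<lambda>k x. block_parity c k x + block_parity c k0 x) ` (K - {k0})"
    have "card ?F \<le> card (K - {k0})" using finK by (intro card_image_le) auto
    then have "card ?F \<le> d" using K(2) k0 by simp
    \<comment> \<open>No transversal agrees with \<open>v\<close> on these functionals, so
      separation is vacuous: it would have \<open>d + 1\<close> blocks of equal parity, but only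
      \<open>d\<close> odd and \<open>d\<close> even ones.\<close>
    moreover have False if b: "b \<in> transversals c d" "\<forall>f\<in>?F. f b = f v" for b
    proof -
      have inj: "inj_on c (supp b)" and "card (supp b) = d"
        using b(1) by (auto simp: transversals_def)
      then have odds: "card (odds b) = d"
        using odds_inj[OF inj] card_image[OF inj] by simp
      moreover have "card ({..<2 * d} - odds b) = 2 * d - card (odds b)"
        by (subst card_Diff_subset) (auto simp: odds_def)
      ultimately have evens: "card ({..<2 * d} - odds b) = d" by simp
      have "block_parity c k b = block_parity c k0 b" if "k \<in> K" for k
      proof (cases "k = k0")
        case False
        then have "block_parity c k b + block_parity c k0 b
            = block_parity c k v + block_parity c k0 v"
          using b(2) that by auto
        also have "\<dots> = 0" using K(3) that k0 by (simp add: bit_add_eq_0_iff)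
        finally show ?thesis by (simp only: bit_add_eq_0_iff)
      qed simp
      then have "K \<subseteq> odds b \<or> K \<subseteq> {..<2 * d} - odds b"
        using K(1) by (cases "block_parity c k0 b") (auto simp: odds_def)
      moreover have "finite (odds b)" "finite ({..<2 * d} - odds b)"
        by (auto simp: odds_def)
      ultimately have "card K \<le> d"
        using card_mono[of "odds b" K] card_mono[of "{..<2 * d} - odds b" K] odds evens by auto
      then show False using K(2) by simp
    qed
    moreover have "\<forall>f\<in>?F. Modules.additive f"
      using additive_plus additive_block_parity by blast
    ultimately show ?thesis
      using finK by (intro exI[of _ ?F]) blast
  qed
qed

section \<open>Counting transversals and evaluating the count\<close>

lemma card_transversals:
  fixes c :: "'n::finite \<Rightarrow> nat"
  shows "card (transversals c d) \<ge>
    (\<Sum>T | T \<subseteq> {..<m} \<and> card T = d. \<Prod>k\<in>T. card (c -` {k}))"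
proof -
  let ?\<T> = "{T. T \<subseteq> {..<m} \<and> card T = d}"
  let ?P = "Sigma ?\<T> (\<lambda>T. \<Pi>\<^sub>E k\<in>T. c -` {k})"
  \<comment> \<open>A pair consists of a set of blocks and a choice of one coordinate in each;
    \<open>\<phi>\<close> is the indicator vector of the chosen coordinates.\<close>
  define \<phi> where "\<phi> p = (\<chi> i. if i \<in> snd p ` fst p then 1 else (0 :: bit))"
    for p :: "nat set \<times> (nat \<Rightarrow> 'n)"
  have finT: "finite T" if "T \<in> ?\<T>" for T
    using that finite_subset by blast
  have supp_\<phi>: "supp (\<phi> p) = snd p ` fst p" for p
    by (auto simp: \<phi>_def supp_def)
  have c_g: "c (g k) = k" if "(T, g) \<in> ?P" "k \<in> T" for T g k
    using that by (auto simp: PiE_def Pi_def)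
  have "\<phi> ` ?P \<subseteq> transversals c d"
  proof safe
    fix T g assume Tg: "T \<subseteq> {..<m}" "d = card T" "g \<in> (\<Pi>\<^sub>E k\<in>T. c -` {k})"
    then have p: "(T, g) \<in> ?P" by auto
    have "inj_on g T" by (rule inj_on_inverseI[of _ c]) (rule c_g[OF p])
    moreover have "inj_on c (g ` T)" by (rule inj_on_inverseI[of _ g]) (auto simp: c_g[OF p])
    ultimately show "\<phi> (T, g) \<in> transversals c (card T)"
      by (simp add: transversals_def supp_\<phi> card_image)
  qed
  moreover have "inj_on \<phi> ?P"
  proof (rule inj_onI)
    fix p p' assume "p \<in> ?P" "p' \<in> ?P" and eq: "\<phi> p = \<phi> p'"
    moreover obtain T g U h where p: "p = (T, g)" "p' = (U, h)" by (cases p; cases p')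
    ultimately have Tg: "(T, g) \<in> ?P" and Uh: "(U, h) \<in> ?P" by simp_all
    have im: "g ` T = h ` U" using eq supp_\<phi>[of p] supp_\<phi>[of p'] by (simp add: p)
    \<comment> \<open>The support determines the pair: its image under \<open>c\<close> is the set
      of blocks, and its single element in block \<open>k\<close> is the choice there.\<close>
    have "T = c ` g ` T" using c_g[OF Tg] by (force simp: image_image)
    also have "\<dots> = U" unfolding im using c_g[OF Uh] by (force simp: image_image)
    finally have TU: "T = U" .
    have "g k = h k" if "k \<in> T" for k
    proof -
      have "g k \<in> h ` U" unfolding im[symmetric] using that by (rule imageI)
      then obtain l where l: "l \<in> U" "g k = h l" by blast
      then have "l = k" using c_g[OF Tg that] c_g[OF Uh l(1)] by simp
      then show ?thesis using l(2) by simp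
    qed
    \<comment> \<open>Extensionality of \<open>PiE\<close> members upgrades agreement on
      \<open>T\<close> to equality of functions.\<close>
    moreover have "g \<in> (\<Pi>\<^sub>E k\<in>T. c -` {k})" "h \<in> (\<Pi>\<^sub>E k\<in>T. c -` {k})"
      using Tg Uh TU by auto
    ultimately have "g = h" by (metis PiE_ext)
    then show "p = p'" using p TU by simp
  qed
  ultimately have "card ?P \<le> card (transversals c d)"
    by (intro card_inj_on_le[of \<phi>]) auto
  moreover have "card ?P = (\<Sum>T\<in>?\<T>. card (\<Pi>\<^sub>E k\<in>T. c -` {k}))"
    using finT by (intro card_SigmaI ballI finite_PiE) auto
  moreover have "\<dots> = (\<Sum>T\<in>?\<T>. \<Prod>k\<in>T. card (c -` {k}))"
    using finT by (intro sum.cong card_PiE) auto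
  ultimately show ?thesis by simp
qed

lemma le_beta:
  fixes B :: "(bit ^ 'n::finite) set"
  assumes "non_blocking d B"
  shows "card B \<le> beta TYPE('n) d"
  unfolding beta_def using assms by (intro Max_ge) auto

text \<open>Passing from \<open>r\<close> to \<open>Suc r\<close> enlarges only the class of
  \<open>r mod n\<close>. When the remainder wraps around to 0, the quotient grows and absorbs the
  extra element of every class.\<close>

lemma card_mod_eq:
  fixes r n k :: nat
  assumes "k < n"
  shows "card {m. m < r \<and> m mod n = k} = r div n + (if k < r mod n then 1 else 0)"
proof (induction r)
  case 0
  then show ?case by simp
next
  case (Suc r)
  have "{m. m < Suc r \<and> m mod n = k} =
      (if r mod n = k then insert r {m. m < r \<and> m mod n = k} else {m. m < r \<and> m mod n = k})"
    by (auto simp: less_Suc_eq)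
  then have "card {m. m < Suc r \<and> m mod n = k}
      = (if r mod n = k then 1 else 0) + card {m. m < r \<and> m mod n = k}"
    by simp
  then show ?case
    using Suc assms mod_less_divisor[of n r] by (auto simp: mod_Suc div_Suc split: if_splits)
qed

text \<open>The product depends only on how many elements of \<open>T\<close> lie on each side of
  \<open>\<rho>\<close>, so the sum is grouped by these two numbers, as in Vandermonde's
  identity.\<close>

lemma sum_prod_two_values:
  fixes a b :: nat
  assumes "\<rho> \<le> m"
  shows "(\<Sum>T | T \<subseteq> {..<m} \<and> card T = d. \<Prod>k\<in>T. if k < \<rho> then b else a) =
    (\<Sum>(i, j) \<in> {(i, j). i \<le> m - \<rho> \<and> j \<le> \<rho> \<and> i + j = d}.
       ((m - \<rho>) choose i) * (\<rho> choose j) * a ^ i * b ^ j)"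
proof -
  let ?\<T> = "{T. T \<subseteq> {..<m} \<and> card T = d}"
  let ?P = "{(i, j). i \<le> m - \<rho> \<and> j \<le> \<rho> \<and> i + j = d}"
  let ?w = "\<lambda>T. \<Prod>k\<in>T. if k < \<rho> then b else a"
  define key where "key T = (card (T \<inter> {\<rho>..<m}), card (T \<inter> {..<\<rho>}))" for T
  have split: "T = (T \<inter> {\<rho>..<m}) \<union> (T \<inter> {..<\<rho>})" if "T \<subseteq> {..<m}" for T
    using that by auto
  have card_split: "card T = card (T \<inter> {\<rho>..<m}) + card (T \<inter> {..<\<rho>})" if "T \<subseteq> {..<m}" for T
    by (subst split[OF that], subst card_Un_disjoint) auto
  have w: "?w T = a ^ card (T \<inter> {\<rho>..<m}) * b ^ card (T \<inter> {..<\<rho>})" if "T \<subseteq> {..<m}" for T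
    by (subst split[OF that], subst prod.union_disjoint) auto
  have "finite ?P"
    by (rule finite_subset[of _ "{..m - \<rho>} \<times> {..\<rho>}"]) auto
  moreover have "key ` ?\<T> \<subseteq> ?P"
  proof
    fix p assume "p \<in> key ` ?\<T>"
    then obtain T where T: "T \<in> ?\<T>" "p = key T" by blast
    have "card (T \<inter> {\<rho>..<m}) \<le> card {\<rho>..<m}" "card (T \<inter> {..<\<rho>}) \<le> card {..<\<rho>}"
      by (intro card_mono; simp)+
    then show "p \<in> ?P" using T card_split[of T] by (simp add: key_def)
  qed
  ultimately have "sum ?w ?\<T> = (\<Sum>p\<in>?P. sum ?w {T \<in> ?\<T>. key T = p})"
    by (intro sum.group[symmetric]) auto
  also have "\<dots> = (\<Sum>(i, j)\<in>?P. ((m - \<rho>) choose i) * (\<rho> choose j) * a ^ i * b ^ j)"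
  proof (rule sum.cong[OF refl], clarify)
    fix i j assume "d = i + j"
    let ?X = "{X. X \<subseteq> {\<rho>..<m} \<and> card X = i}" and ?Y = "{Y. Y \<subseteq> {..<\<rho>} \<and> card Y = j}"
    \<comment> \<open>A set in the fibre of \<open>key\<close> is freely assembled from an
      \<open>i\<close>-subset above and a \<open>j\<close>-subset below the threshold.\<close>
    have "bij_betw (\<lambda>T. (T \<inter> {\<rho>..<m}, T \<inter> {..<\<rho>})) {T. T \<subseteq> {..<m} \<and> card T = i + j \<and> key T = (i, j)} (?X \<times> ?Y)"
    proof (rule bij_betw_byWitness[of _ "\<lambda>(X, Y). X \<union> Y"])
      have "X \<union> Y \<subseteq> {..<m} \<and> card (X \<union> Y) = i + j \<and> key (X \<union> Y) = (i, j)"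
        if "X \<in> ?X" "Y \<in> ?Y" for X Y
      proof -
        have "(X \<union> Y) \<inter> {\<rho>..<m} = X" "(X \<union> Y) \<inter> {..<\<rho>} = Y" using that by auto
        moreover have "X \<union> Y \<subseteq> {..<m}" using that assms by auto
        ultimately show ?thesis using that card_split[of "X \<union> Y"] by (simp add: key_def)
      qed
      then show "(\<lambda>(X, Y). X \<union> Y) ` (?X \<times> ?Y)
          \<subseteq> {T. T \<subseteq> {..<m} \<and> card T = i + j \<and> key T = (i, j)}"
        by auto
    qed (auto simp: key_def)
    then have "card {T. T \<subseteq> {..<m} \<and> card T = i + j \<and> key T = (i, j)} = card (?X \<times> ?Y)"
      by (rule bij_betw_same_card)
    also have "\<dots> = ((m - \<rho>) choose i) * (\<rho> choose j)"
      by (simp add: card_cartesian_product n_subsets)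
    finally have card: "card {T. T \<subseteq> {..<m} \<and> card T = i + j \<and> key T = (i, j)}
      = ((m - \<rho>) choose i) * (\<rho> choose j)" .
    have "sum ?w {T \<in> {T. T \<subseteq> {..<m} \<and> card T = i + j}. key T = (i, j)}
        = (\<Sum>T | T \<subseteq> {..<m} \<and> card T = i + j \<and> key T = (i, j). a ^ i * b ^ j)"
      by (rule sum.cong) (auto simp: w key_def)
    then show "sum ?w {T \<in> {T. T \<subseteq> {..<m} \<and> card T = i + j}. key T = (i, j)}
        = ((m - \<rho>) choose i) * (\<rho> choose j) * a ^ i * b ^ j"
      by (simp add: card)
  qed
  finally show ?thesis .
qed

section \<open>The balanced partition and the two lower bounds\<close>

theorem theorem7:
  fixes r d \<rho> :: nat
  assumes "CARD('n::finite) = r"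
    and "2 \<le> d" and "real d \<le> real r / 2"
    and "\<rho> = r mod (2 * d)"
  shows "beta TYPE('n) d \<ge>
      (\<Sum>(i, j) \<in> {(i, j). i \<le> 2 * d - \<rho> \<and> j \<le> \<rho> \<and> i + j = d}.
         ((2 * d - \<rho>) choose i) * (\<rho> choose j)
           * (r div (2 * d)) ^ i * (r div (2 * d) + 1) ^ j) \<and>
    beta TYPE('n) d \<ge> ((2 * d) choose d) * (r div (2 * d)) ^ d"
proof -
  let ?q = "r div (2 * d)"
  let ?\<T> = "{T. T \<subseteq> {..<2 * d} \<and> card T = d}"
  let ?s = "\<lambda>k. if k < \<rho> then ?q + 1 else ?q"
  obtain h :: "'n \<Rightarrow> nat" where h: "bij_betw h UNIV {0..<r}"
    using ex_bij_betw_finite_nat[of "UNIV :: 'n set"] assms(1) by auto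
  \<comment> \<open>Residues of a numbering of the coordinates give balanced blocks: those with
    index below \<open>\<rho>\<close> have one coordinate more than the others.\<close>
  define c where "c i = h i mod (2 * d)" for i
  have size: "card (c -` {k}) = ?s k" if "k < 2 * d" for k
  proof -
    have "h ` (c -` {k}) = {m. m < r \<and> m mod (2 * d) = k}"
    proof (rule antisym; rule subsetI)
      fix m assume "m \<in> {m. m < r \<and> m mod (2 * d) = k}"
      moreover from this obtain i where "m = h i"
        using bij_betw_imp_surj_on[OF h] by (metis (mono_tags) atLeastLessThan_iff image_iff mem_Collect_eq zero_le)
      ultimately show "m \<in> h ` (c -` {k})" by (simp add: c_def)
    qed (use bij_betw_apply[OF h] in \<open>auto simp: c_def\<close>)
    moreover have "inj_on h (c -` {k})"
      using bij_betw_imp_inj_on[OF h] by (rule inj_on_subset) simp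
    ultimately have "card (c -` {k}) = card {m. m < r \<and> m mod (2 * d) = k}"
      using card_image by metis
    then show ?thesis using card_mod_eq[OF that, of r] assms(4) by simp
  qed
  have "non_blocking d (transversals c d)"
    using assms(1-3) by (intro non_blocking_transversals) (auto simp: c_def)
  then have "(\<Sum>T\<in>?\<T>. \<Prod>k\<in>T. card (c -` {k})) \<le> beta TYPE('n) d"
    using card_transversals[where m = "2 * d"] le_beta le_trans by blast
  also have "(\<Sum>T\<in>?\<T>. \<Prod>k\<in>T. card (c -` {k})) = (\<Sum>T\<in>?\<T>. \<Prod>k\<in>T. ?s k)"
    using size by (intro sum.cong prod.cong) auto
  finally have *: "(\<Sum>T\<in>?\<T>. \<Prod>k\<in>T. ?s k) \<le> beta TYPE('n) d" .
  have "\<rho> \<le> 2 * d" using assms(2,4) by (simp add: less_imp_le)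
  from * sum_prod_two_values[OF this, where d = d and a = ?q and b = "?q + 1"]
  have 1: "(\<Sum>(i, j) \<in> {(i, j). i \<le> 2 * d - \<rho> \<and> j \<le> \<rho> \<and> i + j = d}.
      ((2 * d - \<rho>) choose i) * (\<rho> choose j) * ?q ^ i * (?q + 1) ^ j) \<le> beta TYPE('n) d"
    by (simp only:)
  \<comment> \<open>For the second bound every block size is lowered to \<open>?q\<close> in the sum
    over \<open>d\<close>-subsets, making all terms equal.\<close>
  have "((2 * d) choose d) * ?q ^ d = (\<Sum>T\<in>?\<T>. \<Prod>k\<in>T. ?q)"
    by (simp add: n_subsets)
  also have "\<dots> \<le> (\<Sum>T\<in>?\<T>. \<Prod>k\<in>T. ?s k)"
    by (intro sum_mono prod_mono) auto
  finally show ?thesis using 1 * by linarith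
qed

end
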